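(* Let $P$ be an $SP$-poset. Then for every $n\ge 0$ the coefficient of $x^n$ in $dd\mathcal{SH}(P)$, multiplied by $(-1)^n$, is the number of right deck-divider shuffles between $P$ and $\langle n\rangle$.
   Context: Posets are finite. $\langle n\rangle$ is the chain $1<2<\cdots<n$. An $SP$-poset is a poset obtained from one-point posets by finitely many applications of disjoint union and ordinal sum. The integers $d_{P,i}$ are defined by $\Omega^\circ(P,x)=\sum_{i=1}^{|P|}d_{P,i}\binom{x}{i}$, where $\Omega^\circ(P,n)$ is the number of strict order-preserving maps $P\to\langle n\rangle$. The right deck-divider shuffle series is $$dd\mathcal{SH}(P)=\sum_{i=1}^{|P|}(-1)^{|P|-i}d_{P,i}(1-x)^{i-1}.$$ A right deck-divider shuffle between $P$ and $\langle n\rangle$ is a configuration obtained by drawing the Hasse diagram of $P$ (smaller elements lower; the heights of the points may be chosen freely subject to this) and $n$ horizontal lines, in such a way that before the first line and after the last line there is at least one point of $P$, and the lines are not consecutive (between any two successive lines there is at least one point of $P$). Only the set of points of $P$ lying in each of the $n+1$ strips determined by the lines matters. Equivalently, it is a chain $\varnothing\subsetneq I_1\subsetneq I_2\subsetneq\cdots\subsetneq I_n\subsetneq P$ of lower sets of $P$, where $I_j$ is the set of points below the $j$-th line. *)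

theory Defs
  imports "HOL-Library.FuncSet" "HOL-Library.Infinite_Set"
    "HOL-Computational_Algebra.Polynomial"
begin

text \<open>
  A poset is represented by its reflexive order relation \<open>P\<close>, with \<open>(x, y) \<in> P\<close> meaning
  \<open>x \<le> y\<close>; its set of points is \<open>Field P\<close>.
\<close>

definition ordinal_sum :: "'a rel \<Rightarrow> 'a rel \<Rightarrow> 'a rel" where
  "ordinal_sum P Q = P \<union> Q \<union> Field P \<times> Field Q"

text \<open>
  Disjoint unions and ordinal sums are formed internally, from posets on disjoint sets of points.
  As the points of the one-element posets are arbitrary, the class is closed under isomorphism.
\<close>

inductive sp_poset :: "'a rel \<Rightarrow> bool" where
  point: "sp_poset {(a, a)}"
| disjoint_union:
    "sp_poset P \<Longrightarrow> sp_poset Q \<Longrightarrow> Field P \<inter> Field Q = {} \<Longrightarrow> sp_poset (P \<union> Q)"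
| ordinal_sum:
    "sp_poset P \<Longrightarrow> sp_poset Q \<Longrightarrow> Field P \<inter> Field Q = {} \<Longrightarrow> sp_poset (ordinal_sum P Q)"

lemma Partial_order_iff:
  "Partial_order R \<longleftrightarrow> (\<forall>x \<in> Field R. (x, x) \<in> R) \<and>
      (\<forall>x y z. (x, y) \<in> R \<longrightarrow> (y, z) \<in> R \<longrightarrow> (x, z) \<in> R) \<and>
      (\<forall>x y. (x, y) \<in> R \<longrightarrow> (y, x) \<in> R \<longrightarrow> x = y)"
  by (auto simp: partial_order_on_def preorder_on_def refl_on_def trans_def antisym_def
      intro: FieldI1 FieldI2)

lemma Partial_order_disjoint_union:
  assumes P: "Partial_order P" and Q: "Partial_order Q" and disj: "Field P \<inter> Field Q = {}"
  shows "Partial_order (P \<union> Q)"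
proof -
  have D: "x \<in> Field R \<and> y \<in> Field R" if "(x, y) \<in> R" for x y and R :: "'a rel"
    using that by (auto simp: Field_def)
  have no: "\<not> ((x, y) \<in> P \<and> (y, z) \<in> Q)" "\<not> ((x, y) \<in> Q \<and> (y, z) \<in> P)" for x y z
    using D[of x y P] D[of y z Q] D[of x y Q] D[of y z P] disj by (meson disjoint_iff)+
  show ?thesis
    using P Q no unfolding Partial_order_iff unfolding Field_Un Un_iff by blast
qed

lemma Partial_order_ordinal_sum:
  assumes P: "Partial_order P" and Q: "Partial_order Q" and disj: "Field P \<inter> Field Q = {}"
  shows "Partial_order (ordinal_sum P Q)"
proof -
  have D: "x \<in> Field R \<and> y \<in> Field R" if "(x, y) \<in> R" for x y and R :: "'a rel"
    using that by (auto simp: Field_def)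
  have F: "Field (ordinal_sum P Q) = Field P \<union> Field Q"
    by (auto simp: ordinal_sum_def Field_def)
  have iff: "(x, y) \<in> ordinal_sum P Q \<longleftrightarrow>
      (x, y) \<in> P \<or> (x, y) \<in> Q \<or> x \<in> Field P \<and> y \<in> Field Q" for x y
    by (auto simp: ordinal_sum_def)
  have disj': "x \<in> Field P \<Longrightarrow> x \<notin> Field Q" for x
    using disj by blast
  show ?thesis
    unfolding Partial_order_iff unfolding F iff
  proof (intro conjI allI impI ballI)
    show "(x, x) \<in> P \<or> (x, x) \<in> Q \<or> x \<in> Field P \<and> x \<in> Field Q" if "x \<in> Field P \<union> Field Q" for x
      using that P Q unfolding Partial_order_iff by blast
    show "(x, z) \<in> P \<or> (x, z) \<in> Q \<or> x \<in> Field P \<and> z \<in> Field Q"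
      if "(x, y) \<in> P \<or> (x, y) \<in> Q \<or> x \<in> Field P \<and> y \<in> Field Q"
        "(y, z) \<in> P \<or> (y, z) \<in> Q \<or> y \<in> Field P \<and> z \<in> Field Q" for x y z
      using that P Q D[of x y P] D[of x y Q] D[of y z P] D[of y z Q] disj'[of y]
      unfolding Partial_order_iff by blast
    show "x = y"
      if "(x, y) \<in> P \<or> (x, y) \<in> Q \<or> x \<in> Field P \<and> y \<in> Field Q"
        "(y, x) \<in> P \<or> (y, x) \<in> Q \<or> y \<in> Field P \<and> x \<in> Field Q" for x y
      using that P Q D[of x y P] D[of x y Q] D[of y x P] D[of y x Q] disj'[of x] disj'[of y]
      unfolding Partial_order_iff by blast
  qed
qed

lemma sp_poset_Partial_order: "sp_poset P \<Longrightarrow> Partial_order P"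
proof (induction rule: sp_poset.induct)
  case (point a)
  show ?case
    unfolding Partial_order_iff by (simp add: Field_def)
qed (rule Partial_order_disjoint_union Partial_order_ordinal_sum; assumption)+

lemma sp_poset_finite_nonempty: "sp_poset P \<Longrightarrow> finite P \<and> P \<noteq> {}"
  by (induction rule: sp_poset.induct) (auto simp: ordinal_sum_def finite_Field)

text \<open>The strict order-preserving maps from \<open>P\<close> to the chain \<open>1 < \<dots> < n\<close>.\<close>

definition strict_order_maps :: "'a rel \<Rightarrow> nat \<Rightarrow> ('a \<Rightarrow> nat) set" where
  "strict_order_maps P n =
     {f \<in> Field P \<rightarrow>\<^sub>E {1..n}. \<forall>x y. (x, y) \<in> P \<and> x \<noteq> y \<longrightarrow> f x < f y}"

definition strict_order_count :: "'a rel \<Rightarrow> nat \<Rightarrow> nat" where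
  "strict_order_count P n = card (strict_order_maps P n)"

text \<open>
  The coefficients of the strict order polynomial in the basis of binomial coefficients. The
  identity of polynomials is expressed by its values at all natural numbers; the coefficients are
  set to \<open>0\<close> outside the range \<open>1 \<le> i \<le> |P|\<close>, which makes the family unique.
\<close>

definition binomial_coeffs :: "'a rel \<Rightarrow> nat \<Rightarrow> int" where
  "binomial_coeffs P =
     (THE d. (\<forall>i. i \<notin> {1..card (Field P)} \<longrightarrow> d i = 0) \<and>
        (\<forall>n. int (strict_order_count P n) = (\<Sum>i = 1..card (Field P). d i * int (n choose i))))"

lemma card_strict_order_maps_image:
  fixes S :: "nat set"
  assumes "finite S"
  shows "card {f \<in> Field P \<rightarrow>\<^sub>E S. f ` Field P = S \<and> (\<forall>x y. (x, y) \<in> P \<and> x \<noteq> y \<longrightarrow> f x < f y)} =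
    card {f \<in> strict_order_maps P (card S). f ` Field P = {1..card S}}" (is "card ?A = card ?B")
proof -
  obtain h where h: "bij_betw h {..<card S} S" "strict_mono_on {..<card S} h"
    using ex_bij_betw_strict_mono_card[OF assms] by blast
  define g where "g i = h (i - 1)" for i :: nat
  have "bij_betw (\<lambda>i::nat. i - 1) {1..card S} {..<card S}"
    by (rule bij_betwI[where g = Suc]) auto
  from bij_betw_trans[OF this h(1)] have g: "bij_betw g {1..card S} S"
    by (simp add: g_def[abs_def] comp_def)
  have mono: "g i < g j \<longleftrightarrow> i < j" if "i \<in> {1..card S}" "j \<in> {1..card S}" for i j
  proof -
    have "g i < g j \<longleftrightarrow> i - 1 < j - 1"
      unfolding g_def using that by (intro strict_mono_on_less[OF h(2)]) auto
    then show ?thesis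
      using that by auto
  qed
  have D: "x \<in> Field P \<and> y \<in> Field P" if "(x, y) \<in> P" for x y
    using that by (auto simp: Field_def)
  let ?g' = "inv_into {1..card S} g"
  have g': "?g' s \<in> {1..card S}" "g (?g' s) = s" if "s \<in> S" for s
    using that g by (simp_all only: bij_betw_def f_inv_into_f inv_into_into)
  have g'g: "?g' (g i) = i" if "i \<in> {1..card S}" for i
    using that g by (simp add: bij_betw_def inv_into_f_f)
  have gS: "g i \<in> S" if "i \<in> {1..card S}" for i
    using that g by (auto simp: bij_betw_def)
  have "bij_betw (\<lambda>f. restrict (g \<circ> f) (Field P)) ?B ?A"
  proof (rule bij_betwI[where g = "\<lambda>f. restrict (?g' \<circ> f) (Field P)"])
    show "(\<lambda>f. restrict (g \<circ> f) (Field P)) \<in> ?B \<rightarrow> ?A"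
    proof
      fix f assume f: "f \<in> ?B"
      then have r: "f x \<in> {1..card S}" if "x \<in> Field P" for x
        using that by blast
      have "(g \<circ> f) ` Field P = S"
        using f g unfolding bij_betw_def image_comp[symmetric] by simp
      moreover have "g (f x) < g (f y)" if "(x, y) \<in> P" "x \<noteq> y" for x y
        using f that D[of x y] r mono by (simp add: strict_order_maps_def)
      ultimately show "restrict (g \<circ> f) (Field P) \<in> ?A"
        using D r gS by auto
    qed
    show "(\<lambda>f. restrict (?g' \<circ> f) (Field P)) \<in> ?A \<rightarrow> ?B"
    proof
      fix f assume f: "f \<in> ?A"
      then have r: "f x \<in> S" if "x \<in> Field P" for x
        using that by blast
      have "?g' ` S = {1..card S}"
        using bij_betw_inv_into[OF g] by (simp add: bij_betw_def)
      then have im: "(?g' \<circ> f) ` Field P = {1..card S}"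
        using f unfolding image_comp[symmetric] by simp
      have "?g' (f x) < ?g' (f y)" if "(x, y) \<in> P" "x \<noteq> y" for x y
        using f that D[of x y] r g' mono[of "?g' (f x)" "?g' (f y)"] by simp
      then show "restrict (?g' \<circ> f) (Field P) \<in> ?B"
        unfolding strict_order_maps_def using D r g' im by auto
    qed
    show "restrict (?g' \<circ> restrict (g \<circ> f) (Field P)) (Field P) = f" if "f \<in> ?B" for f
    proof
      fix x
      show "restrict (?g' \<circ> restrict (g \<circ> f) (Field P)) (Field P) x = f x"
      proof (cases "x \<in> Field P")
        case True
        then have "f x \<in> {1..card S}"
          using that by blast
        then show ?thesis
          using True g'g by simp
      next
        case False
        then show ?thesis
          using that by (auto simp: strict_order_maps_def PiE_def extensional_def)
      qed
    qed
    show "restrict (g \<circ> restrict (?g' \<circ> f) (Field P)) (Field P) = f" if "f \<in> ?A" for f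
    proof
      fix x
      show "restrict (g \<circ> restrict (?g' \<circ> f) (Field P)) (Field P) x = f x"
      proof (cases "x \<in> Field P")
        case True
        then have "f x \<in> S"
          using that by blast
        then show ?thesis
          using True g' by simp
      next
        case False
        then show ?thesis
          using that by (auto simp: PiE_def extensional_def)
      qed
    qed
  qed
  then show ?thesis
    by (simp add: bij_betw_same_card)
qed

lemma binomial_coeffs_ex1:
  assumes fin: "finite (Field P)" and ne: "Field P \<noteq> {}"
  shows "\<exists>!d :: nat \<Rightarrow> int. (\<forall>i. i \<notin> {1..card (Field P)} \<longrightarrow> d i = 0) \<and>
    (\<forall>n. int (strict_order_count P n) = (\<Sum>i = 1..card (Field P). d i * int (n choose i)))"
proof (rule ex_ex1I)
  let ?B = "\<lambda>i. {f \<in> strict_order_maps P i. f ` Field P = {1..i}}"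
  let ?A = "\<lambda>S. {f \<in> Field P \<rightarrow>\<^sub>E S. f ` Field P = S \<and> (\<forall>x y. (x, y) \<in> P \<and> x \<noteq> y \<longrightarrow> f x < f y)}"
  let ?m = "card (Field P)"
  have zero: "card (?B i) = 0" if "i \<notin> {1..?m}" for i
  proof -
    have "f ` Field P \<noteq> {1..i}" for f :: "'a \<Rightarrow> nat"
    proof
      assume im: "f ` Field P = {1..i}"
      have "i \<le> ?m"
        using card_image_le[OF fin, of f] im by simp
      moreover have "i \<noteq> 0"
        using im ne by auto
      ultimately show False
        using that by auto
    qed
    then show ?thesis
      by simp
  qed
  have count: "strict_order_count P n = (\<Sum>i = 1..?m. card (?B i) * (n choose i))" for n
  proof -
    have "strict_order_maps P n = (\<Union>S \<in> Pow {1..n}. ?A S)"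
      by (auto simp: strict_order_maps_def PiE_iff)
    then have "strict_order_count P n = card (\<Union>S \<in> Pow {1..n}. ?A S)"
      by (simp add: strict_order_count_def)
    also have "\<dots> = (\<Sum>S \<in> Pow {1..n}. card (?A S))"
    proof (rule card_UN_disjoint)
      show "\<forall>S \<in> Pow {1..n}. finite (?A S)"
      proof
        fix S assume "S \<in> Pow {1..n}"
        then have "finite (Field P \<rightarrow>\<^sub>E S)"
          using fin by (intro finite_PiE) (auto dest: finite_subset)
        then show "finite (?A S)"
          by simp
      qed
    qed auto
    also have "\<dots> = (\<Sum>S \<in> Pow {1..n}. card (?B (card S)))"
      by (intro sum.cong refl card_strict_order_maps_image) (auto dest: finite_subset)
    also have "\<dots> = (\<Sum>i \<in> {..n}. \<Sum>S | S \<in> Pow {1..n} \<and> card S = i. card (?B (card S)))"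
      by (rule sum.group[symmetric]) (auto dest: card_mono[rotated])
    also have "\<dots> = (\<Sum>i \<in> {..n}. card (?B i) * (n choose i))"
    proof (rule sum.cong)
      fix i
      have "card {S. S \<in> Pow {1..n} \<and> card S = i} = n choose i"
        using n_subsets[of "{1..n}" i] by simp
      then show "(\<Sum>S | S \<in> Pow {1..n} \<and> card S = i. card (?B (card S))) = card (?B i) * (n choose i)"
        by simp
    qed simp
    also have "\<dots> = (\<Sum>i \<in> {..n} \<union> {1..?m}. card (?B i) * (n choose i))"
      by (rule sum.mono_neutral_left) (auto simp: binomial_eq_0)
    also have "\<dots> = (\<Sum>i = 1..?m. card (?B i) * (n choose i))"
      by (rule sum.mono_neutral_right) (use zero in auto)
    finally show ?thesis .
  qed
  show "\<exists>d :: nat \<Rightarrow> int. (\<forall>i. i \<notin> {1..?m} \<longrightarrow> d i = 0) \<and>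
    (\<forall>n. int (strict_order_count P n) = (\<Sum>i = 1..?m. d i * int (n choose i)))"
    using zero count by (intro exI[of _ "\<lambda>i. int (card (?B i))"]) simp
next
  fix d e :: "nat \<Rightarrow> int"
  let ?m = "card (Field P)"
  assume d: "(\<forall>i. i \<notin> {1..?m} \<longrightarrow> d i = 0) \<and>
      (\<forall>n. int (strict_order_count P n) = (\<Sum>i = 1..?m. d i * int (n choose i)))"
    and e: "(\<forall>i. i \<notin> {1..?m} \<longrightarrow> e i = 0) \<and>
      (\<forall>n. int (strict_order_count P n) = (\<Sum>i = 1..?m. e i * int (n choose i)))"
  have "d n = e n" for n
  proof (induction n rule: less_induct)
    case (less n)
    show ?case
    proof (cases "n \<in> {1..?m}")
      case True
      have *: "(\<Sum>i = 1..?m. c i * int (n choose i)) =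
          c n + (\<Sum>i \<in> {1..?m} - {n}. c i * int (n choose i))" for c :: "nat \<Rightarrow> int"
        using True by (simp add: sum.remove)
      have "d i * int (n choose i) = e i * int (n choose i)" if "i \<noteq> n" for i
        using less that by (cases "i < n") (auto simp: binomial_eq_0)
      then have "(\<Sum>i \<in> {1..?m} - {n}. d i * int (n choose i)) =
          (\<Sum>i \<in> {1..?m} - {n}. e i * int (n choose i))"
        by (intro sum.cong) auto
      moreover have "(\<Sum>i = 1..?m. d i * int (n choose i)) = (\<Sum>i = 1..?m. e i * int (n choose i))"
        using d e by metis
      ultimately show ?thesis
        unfolding * by simp
    next
      case False
      then show ?thesis
        using d e by simp
    qed
  qed
  then show "d = e"
    by blast
qed

definition ddSH :: "'a rel \<Rightarrow> int poly" where
  "ddSH P = (\<Sum>i = 1..card (Field P).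
     smult ((- 1) ^ (card (Field P) - i) * binomial_coeffs P i) ([:1, - 1:] ^ (i - 1)))"

definition lower_set :: "'a rel \<Rightarrow> 'a set \<Rightarrow> bool" where
  "lower_set P I \<longleftrightarrow> I \<subseteq> Field P \<and> (\<forall>x y. (x, y) \<in> P \<and> y \<in> I \<longrightarrow> x \<in> I)"

text \<open>
  A shuffle is recorded by the list of the lower sets \<open>I\<^sub>1, \<dots>, I\<^sub>n\<close> of points lying below
  the successive divider lines.
\<close>

definition right_deck_divider_shuffles :: "'a rel \<Rightarrow> nat \<Rightarrow> 'a set list set" where
  "right_deck_divider_shuffles P n =
     {Is. length Is = n \<and> (\<forall>I \<in> set Is. lower_set P I) \<and>
        sorted_wrt (\<subset>) ({} # Is @ [Field P])}"

end

theory Submission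
  imports Defs
begin

text \<open>
  For a lower set \<open>U\<close>, let \<open>g k U\<close> be the number of chains of lower sets with \<open>k\<close> strict
  inclusions from \<open>{}\<close> to \<open>U\<close>, and \<open>s i U\<close> the number of strict order-preserving surjections
  from \<open>U\<close> onto \<open>{1..i}\<close>. Removing the fibre over the top element gives
  \<open>s (i + 1) U = (\<Sum>A. s i (U - A))\<close>, where \<open>A\<close> ranges over the nonempty sets of maximal
  elements of \<open>U\<close>. Summing \<open>g k\<close> over all lower sets contained in \<open>U\<close> gives
  \<open>g k U + g (k + 1) U\<close>. A lower set \<open>V \<subseteq> U\<close> containing all maximal elements of \<open>U\<close> is
  \<open>U\<close>, so inclusion-exclusion over the maximal elements missed by \<open>V\<close> gives
  \<open>g (k + 1) U = (\<Sum>A. (-1) ^ (|A| + 1) * (g k (U - A) + g (k + 1) (U - A)))\<close>, which is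
  solved by the alternating sum of \<open>s (i + 1) U * (i choose k)\<close>.
\<close>

section \<open>Maximal elements and the two counting functions\<close>

definition maximal_points :: "'a rel \<Rightarrow> 'a set \<Rightarrow> 'a set" where
  "maximal_points P U = {x \<in> U. \<forall>y \<in> U. (x, y) \<in> P \<longrightarrow> y = x}"

definition strict_maps_on :: "'a rel \<Rightarrow> 'a set \<Rightarrow> nat \<Rightarrow> ('a \<Rightarrow> nat) set" where
  "strict_maps_on P U n =
     {f \<in> U \<rightarrow>\<^sub>E {1..n}. \<forall>x \<in> U. \<forall>y \<in> U. (x, y) \<in> P \<and> x \<noteq> y \<longrightarrow> f x < f y}"

text \<open>This is \<open>s i U\<close>, with the removal of the top fibre taken as its definition.
  The link to maps is \<open>card_strict_maps_on_binomial\<close>.\<close>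

primrec strict_surj_count :: "'a rel \<Rightarrow> nat \<Rightarrow> 'a set \<Rightarrow> int" where
  "strict_surj_count P 0 U = of_bool (U = {})"
| "strict_surj_count P (Suc i) U =
     (\<Sum>A \<in> Pow (maximal_points P U) - {{}}. strict_surj_count P i (U - A))"

text \<open>This is \<open>g k U\<close>, splitting off the last inclusion. The index counts
  inclusions, so \<open>n\<close> divider lines correspond to \<open>Suc n\<close>.\<close>

primrec chain_count :: "'a rel \<Rightarrow> nat \<Rightarrow> 'a set \<Rightarrow> int" where
  "chain_count P 0 U = of_bool (U = {})"
| "chain_count P (Suc k) U = (\<Sum>V | lower_set P V \<and> V \<subset> U. chain_count P k V)"

lemma maximal_points_subset: "maximal_points P U \<subseteq> U"
  by (auto simp: maximal_points_def)

lemma lower_set_Diff_maximal_points: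
  assumes "lower_set P U" "A \<subseteq> maximal_points P U"
  shows "lower_set P (U - A)"
  using assms unfolding lower_set_def maximal_points_def by blast

section \<open>The strict order polynomial in the binomial basis\<close>

lemma strict_order_maps_eq: "strict_order_maps P n = strict_maps_on P (Field P) n"
  by (auto simp: strict_order_maps_def strict_maps_on_def intro: FieldI1 FieldI2)

lemma finite_strict_maps_on: "finite U \<Longrightarrow> finite (strict_maps_on P U n)"
  unfolding strict_maps_on_def by (rule finite_subset[of _ "U \<rightarrow>\<^sub>E {1..n}"]) (auto intro: finite_PiE)

text \<open>A strict map is determined by its fibre over \<open>Suc n\<close>, which consists of
  maximal elements, and its restriction to the rest, with values in \<open>{1..n}\<close>. The fibre
  may be empty here.\<close>

lemma card_strict_maps_on_Suc:
  fixes P :: "'a rel"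
  assumes "finite U"
  shows "card (strict_maps_on P U (Suc n)) =
    (\<Sum>A \<in> Pow (maximal_points P U). card (strict_maps_on P (U - A) n))"
proof -
  let ?M = "maximal_points P U"
  let ?top = "\<lambda>f. {x \<in> U. f x = Suc n}"
  let ?Sig = "SIGMA A:Pow ?M. strict_maps_on P (U - A) n"
  \<comment> \<open>Glues a fibre to a map on the rest. Outside \<open>U\<close> the value
    \<open>undefined\<close> is inherited from \<open>f\<close>, so the result stays
    extensional.\<close>
  define ext where "ext = (\<lambda>(A :: 'a set, f) x. if x \<in> A then Suc n else f x :: nat)"
  have "bij_betw ext ?Sig (strict_maps_on P U (Suc n))"
  proof (rule bij_betwI[where g = "\<lambda>f. (?top f, restrict f (U - ?top f))"])
    show "ext \<in> ?Sig \<rightarrow> strict_maps_on P U (Suc n)"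
    proof
      fix p assume "p \<in> ?Sig"
      then obtain A f where p: "p = (A, f)" "A \<subseteq> ?M" "f \<in> strict_maps_on P (U - A) n"
        by blast
      have r: "f x \<in> {1..n}" if "x \<in> U - A" for x
        using p(3) that unfolding strict_maps_on_def by blast
      have "ext p \<in> U \<rightarrow>\<^sub>E {1..Suc n}"
      proof (rule PiE_I)
        fix x
        show "ext p x \<in> {1..Suc n}" if "x \<in> U"
          using r[of x] that p(1) by (auto simp: ext_def)
        show "ext p x = undefined" if "x \<notin> U"
          using that p maximal_points_subset[of P U]
          by (auto simp: ext_def strict_maps_on_def PiE_def extensional_def)
      qed
      moreover have "ext p x < ext p y" if xy: "x \<in> U" "y \<in> U" "(x, y) \<in> P" "x \<noteq> y" for x y
      proof -
        have x: "x \<notin> A"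
          using xy p(2) unfolding maximal_points_def by blast
        show ?thesis
        proof (cases "y \<in> A")
          case True
          then show ?thesis
            using x xy r[of x] p(1) by (auto simp: ext_def)
        next
          case False
          then show ?thesis
            using x xy p(1,3) by (simp add: ext_def strict_maps_on_def)
        qed
      qed
      ultimately show "ext p \<in> strict_maps_on P U (Suc n)"
        by (simp add: strict_maps_on_def)
    qed
    show "(\<lambda>f. (?top f, restrict f (U - ?top f))) \<in> strict_maps_on P U (Suc n) \<rightarrow> ?Sig"
    proof
      fix f assume f: "f \<in> strict_maps_on P U (Suc n)"
      have r: "1 \<le> f x \<and> f x \<le> Suc n" if "x \<in> U" for x
        using f that by (auto simp: strict_maps_on_def PiE_iff)
      have lt: "f x < f y" if "x \<in> U" "y \<in> U" "(x, y) \<in> P" "x \<noteq> y" for x y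
        using f that by (simp add: strict_maps_on_def)
      have "?top f \<subseteq> ?M"
      proof
        fix x assume x: "x \<in> ?top f"
        have "y = x" if "y \<in> U" "(x, y) \<in> P" for y
          using that lt[of x y] r[of y] x by fastforce
        then show "x \<in> ?M"
          using x by (simp add: maximal_points_def)
      qed
      moreover have "restrict f (U - ?top f) \<in> strict_maps_on P (U - ?top f) n"
        using r lt by (fastforce simp: strict_maps_on_def le_Suc_eq)
      ultimately show "(?top f, restrict f (U - ?top f)) \<in> ?Sig"
        by blast
    qed
    show "(?top (ext p), restrict (ext p) (U - ?top (ext p))) = p" if mem: "p \<in> ?Sig" for p
    proof -
      obtain A f where p: "p = (A, f)" "A \<subseteq> ?M" "f \<in> strict_maps_on P (U - A) n"
        using mem by blast
      have r: "f x \<noteq> Suc n" if "x \<in> U - A" for x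
      proof -
        have "f x \<in> {1..n}"
          using p(3) that unfolding strict_maps_on_def by blast
        then show ?thesis
          by simp
      qed
      have top: "?top (ext p) = A"
        using r p(1,2) maximal_points_subset[of P U] by (auto simp: ext_def split: if_splits)
      have "restrict (ext p) (U - A) = f"
        using p by (auto simp: ext_def strict_maps_on_def fun_eq_iff PiE_def extensional_def)
      then show ?thesis
        unfolding top using p(1) by simp
    qed
    show "ext (?top f, restrict f (U - ?top f)) = f" if "f \<in> strict_maps_on P U (Suc n)" for f
      using that by (auto simp: ext_def strict_maps_on_def fun_eq_iff PiE_def extensional_def)
  qed
  then have "card (strict_maps_on P U (Suc n)) = card ?Sig"
    by (simp add: bij_betw_same_card)
  also have "\<dots> = (\<Sum>A \<in> Pow ?M. card (strict_maps_on P (U - A) n))"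
    using assms maximal_points_subset[of P U]
    by (intro card_SigmaI) (auto intro: finite_strict_maps_on finite_subset)
  finally show ?thesis .
qed

lemma sum_Pow_split_empty:
  fixes h :: "'a set \<Rightarrow> int"
  assumes "finite M"
  shows "(\<Sum>A \<in> Pow M. h A) = h {} + (\<Sum>A \<in> Pow M - {{}}. h A)"
  using assms by (simp add: sum.remove)

text \<open>Pascal's rule: in the recursion over fibres, \<open>A = {}\<close> contributes
  \<open>s i U\<close> and the nonempty \<open>A\<close> together contribute
  \<open>s (i + 1) U\<close>.\<close>

lemma card_strict_maps_on_binomial:
  assumes "finite U"
  shows "int (card (strict_maps_on P U n)) =
    (\<Sum>i\<le>n. strict_surj_count P i U * int (n choose i))"
  using assms
proof (induction n arbitrary: U)
  case 0
  show ?case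
    by (auto simp: strict_maps_on_def PiE_eq_empty_iff)
next
  case (Suc n)
  let ?M = "maximal_points P U"
  have M: "finite ?M"
    by (rule finite_subset[OF maximal_points_subset Suc.prems])
  have "int (card (strict_maps_on P U (Suc n))) =
      (\<Sum>A \<in> Pow ?M. int (card (strict_maps_on P (U - A) n)))"
    by (simp add: card_strict_maps_on_Suc Suc.prems)
  also have "\<dots> = (\<Sum>A \<in> Pow ?M. \<Sum>i\<le>n. strict_surj_count P i (U - A) * int (n choose i))"
    using Suc by simp
  also have "\<dots> = (\<Sum>i\<le>n. (\<Sum>A \<in> Pow ?M. strict_surj_count P i (U - A)) * int (n choose i))"
    by (subst sum.swap) (simp add: sum_distrib_right)
  also have "\<dots> = (\<Sum>i\<le>n. (strict_surj_count P i U + strict_surj_count P (Suc i) U) * int (n choose i))"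
    using M by (simp add: sum_Pow_split_empty)
  also have "\<dots> = (\<Sum>i\<le>n. strict_surj_count P i U * int (n choose i)) +
      (\<Sum>i\<le>n. strict_surj_count P (Suc i) U * int (n choose i))"
    by (simp only: distrib_right sum.distrib)
  \<comment> \<open>The added term vanishes because \<open>n choose Suc n\<close> is 0; shifting
    then aligns this sum with the other one.\<close>
  also have "(\<Sum>i\<le>n. strict_surj_count P i U * int (n choose i)) =
      (\<Sum>i\<le>Suc n. strict_surj_count P i U * int (n choose i))"
    by simp
  also have "\<dots> = strict_surj_count P 0 U +
      (\<Sum>i\<le>n. strict_surj_count P (Suc i) U * int (n choose Suc i))"
    by (subst sum.atMost_Suc_shift) simp
  finally show ?case
    by (subst sum.atMost_Suc_shift)
      (simp del: strict_surj_count.simps add: algebra_simps sum.distrib)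
qed

text \<open>Each unfolding removes at least one point. This yields the support condition in
  \<open>binomial_coeffs\<close>.\<close>

lemma strict_surj_count_eq_0:
  assumes "finite U" "card U < i"
  shows "strict_surj_count P i U = 0"
  using assms
proof (induction i arbitrary: U)
  case (Suc i)
  have "strict_surj_count P i (U - A) = 0" if "A \<in> Pow (maximal_points P U) - {{}}" for A
  proof (rule Suc.IH)
    have "A \<subseteq> U" "A \<noteq> {}"
      using that maximal_points_subset[of P U] by auto
    then have "U - A \<subset> U"
      by blast
    with Suc.prems show "card (U - A) < i"
      using psubset_card_mono[of U "U - A"] by linarith
  qed (simp add: Suc.prems)
  then show ?case
    by simp
qed simp

text \<open>The numbers \<open>s i (Field P)\<close> satisfy both defining conditions, so uniqueness
  identifies them.\<close>

lemma binomial_coeffs_eq_strict_surj_count: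
  assumes "finite P" "P \<noteq> {}"
  shows "binomial_coeffs P i = strict_surj_count P i (Field P)"
proof -
  have F: "finite (Field P)" "Field P \<noteq> {}"
    using assms by (simp add: finite_Field, auto simp: Field_def)
  have zero: "strict_surj_count P i (Field P) = 0" if "i \<notin> {1..card (Field P)}" for i
  proof (cases i)
    case 0
    then show ?thesis
      using F by simp
  next
    case (Suc j)
    then show ?thesis
      using that F by (intro strict_surj_count_eq_0) auto
  qed
  have count: "int (strict_order_count P n) =
      (\<Sum>i = 1..card (Field P). strict_surj_count P i (Field P) * int (n choose i))" for n
  proof -
    have "int (strict_order_count P n) =
        (\<Sum>i\<le>n. strict_surj_count P i (Field P) * int (n choose i))"
      by (simp add: strict_order_count_def strict_order_maps_eq card_strict_maps_on_binomial F)
    \<comment> \<open>Both ranges are compared with their union: binomials vanish beyond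
      \<open>n\<close>, the counts outside \<open>{1..card (Field P)}\<close>.\<close>
    also have "\<dots> = (\<Sum>i \<in> {..n} \<union> {1..card (Field P)}.
        strict_surj_count P i (Field P) * int (n choose i))"
      by (rule sum.mono_neutral_left) (auto simp: binomial_eq_0)
    also have "\<dots> = (\<Sum>i = 1..card (Field P). strict_surj_count P i (Field P) * int (n choose i))"
      by (rule sum.mono_neutral_right) (use zero in auto)
    finally show ?thesis .
  qed
  have "binomial_coeffs P = (\<lambda>i. strict_surj_count P i (Field P))"
    unfolding binomial_coeffs_def
    by (rule the1_equality[OF binomial_coeffs_ex1[OF F]]) (use zero count in blast)
  then show ?thesis
    by simp
qed

section \<open>Inclusion-exclusion over maximal elements\<close>

lemma maximal_points_subset_imp_eq:
  assumes P: "Partial_order P" and fin: "finite P"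
    and V: "lower_set P V" "V \<subseteq> U" and max: "maximal_points P U \<subseteq> V"
  shows "V = U"
proof (rule ccontr)
  assume "V \<noteq> U"
  then have ne: "U - V \<noteq> {}"
    using V by blast
  have "trans P" "antisym P"
    using P by (auto simp: partial_order_on_def preorder_on_def)
  then have "acyclic (P - Id)"
    by (auto simp: acyclic_def trans_diff_Id)
  then have "wf ((P - Id)\<inverse>)"
    using fin by (simp add: finite_acyclic_wf_converse)
  then obtain x where x: "x \<in> U - V" "\<And>y. (x, y) \<in> P - Id \<Longrightarrow> y \<notin> U - V"
    using ne unfolding wf_eq_minimal by (metis converse_iff ex_in_conv)
  \<comment> \<open>An element of \<open>V\<close> above \<open>x\<close> would force
    \<open>x\<close> into the lower set \<open>V\<close>, so maximality in \<open>U - V\<close>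
    passes to \<open>U\<close>.\<close>
  have "x \<in> maximal_points P U"
    using x V(1) unfolding maximal_points_def lower_set_def by blast
  then show False
    using x max by blast
qed

text \<open>Expansion of the product of \<open>1 - 1\<close> over \<open>M\<close>.\<close>

lemma sum_Pow_minus_one_power_card:
  assumes "finite M"
  shows "(\<Sum>A \<in> Pow M. (- 1) ^ card A :: int) = of_bool (M = {})"
  using prod_diff_conv_sum[OF assms, of "\<lambda>_. 1 :: int" "\<lambda>_. 1"] assms
  by (simp add: power_0_left split: if_splits)

text \<open>After exchanging sums, \<open>h V\<close> is weighted by the alternating sum over the
  sets of maximal elements disjoint from \<open>V\<close>. It is 1 if \<open>V\<close> contains all
  maximal elements, that is \<open>V = U\<close>, and 0 otherwise.\<close>

lemma inclusion_exclusion_lower_sets: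
  fixes h :: "'a set \<Rightarrow> int"
  assumes P: "Partial_order P" and fin: "finite P" and U: "lower_set P U"
  shows "(\<Sum>A \<in> Pow (maximal_points P U). (- 1) ^ card A * (\<Sum>V | lower_set P V \<and> V \<subseteq> U - A. h V)) = h U"
proof -
  let ?M = "maximal_points P U" and ?L = "{V. lower_set P V \<and> V \<subseteq> U}"
  have finU: "finite U"
    using U fin finite_Field finite_subset unfolding lower_set_def by blast
  then have L: "finite ?L" and M: "finite ?M"
    using maximal_points_subset[of P U] by (auto intro: finite_subset[of _ "Pow U"] finite_subset)
  have "(\<Sum>V | lower_set P V \<and> V \<subseteq> U - A. h V) = (\<Sum>V \<in> ?L. if A \<inter> V = {} then h V else 0)" for A
    by (subst sum.inter_filter[OF L, symmetric]) (rule sum.cong; auto)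
  then have "(\<Sum>A \<in> Pow ?M. (- 1) ^ card A * (\<Sum>V | lower_set P V \<and> V \<subseteq> U - A. h V)) =
      (\<Sum>A \<in> Pow ?M. \<Sum>V \<in> ?L. (- 1) ^ card A * (if A \<inter> V = {} then h V else 0))"
    by (simp add: sum_distrib_left)
  also have "\<dots> = (\<Sum>V \<in> ?L. \<Sum>A \<in> Pow ?M. (- 1) ^ card A * (if A \<inter> V = {} then h V else 0))"
    by (rule sum.swap)
  also have "\<dots> = (\<Sum>V \<in> ?L. if V = U then h V else 0)"
  proof (rule sum.cong)
    fix V assume V: "V \<in> ?L"
    have "(\<Sum>A \<in> Pow ?M. (- 1) ^ card A * (if A \<inter> V = {} then h V else 0)) =
        (\<Sum>A \<in> Pow ?M. if A \<inter> V = {} then (- 1) ^ card A * h V else 0)"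
      by (rule sum.cong) auto
    also have "\<dots> = (\<Sum>A \<in> {A \<in> Pow ?M. A \<inter> V = {}}. (- 1) ^ card A * h V)"
      using M by (intro sum.inter_filter[symmetric]) simp
    also have "{A \<in> Pow ?M. A \<inter> V = {}} = Pow (?M - V)"
      by blast
    also have "(\<Sum>A \<in> Pow (?M - V). (- 1) ^ card A * h V) = of_bool (?M - V = {}) * h V"
      using M by (simp only: sum_distrib_right[symmetric] sum_Pow_minus_one_power_card finite_Diff)
    also have "\<dots> = (if V = U then h V else 0)"
      using maximal_points_subset_imp_eq[OF P fin, of V U] V maximal_points_subset[of P U] by auto
    finally show "(\<Sum>A \<in> Pow ?M. (- 1) ^ card A * (if A \<inter> V = {} then h V else 0)) =
        (if V = U then h V else 0)" .
  qed simp
  also have "\<dots> = h U"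
    using L U by simp
  finally show ?thesis .
qed

section \<open>The alternating formula for chain counts\<close>

lemma sum_chain_count_subset:
  assumes "finite U" "lower_set P U"
  shows "(\<Sum>V | lower_set P V \<and> V \<subseteq> U. chain_count P k V) = chain_count P k U + chain_count P (Suc k) U"
proof -
  have "{V. lower_set P V \<and> V \<subseteq> U} = insert U {V. lower_set P V \<and> V \<subset> U}"
    using assms by auto
  moreover have "finite {V. lower_set P V \<and> V \<subset> U}"
    using assms by (auto intro: finite_subset[of _ "Pow U"])
  ultimately show ?thesis
    by simp
qed

text \<open>Inclusion-exclusion with \<open>h = chain_count P k\<close>; the term
  \<open>A = {}\<close> contains \<open>chain_count P k U\<close>, which cancels the left
  side.\<close>

lemma chain_count_Suc_alternating:
  assumes P: "Partial_order P" and fin: "finite P" and U: "lower_set P U"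
  shows "chain_count P (Suc k) U = (\<Sum>A \<in> Pow (maximal_points P U) - {{}}.
    (- 1) ^ Suc (card A) * (chain_count P k (U - A) + chain_count P (Suc k) (U - A)))"
proof -
  let ?M = "maximal_points P U"
  let ?T = "\<lambda>A. chain_count P k (U - A) + chain_count P (Suc k) (U - A)"
  have finU: "finite U"
    using U fin finite_Field finite_subset unfolding lower_set_def by blast
  then have M: "finite ?M"
    by (rule finite_subset[OF maximal_points_subset])
  have "chain_count P k U = (\<Sum>A \<in> Pow ?M. (- 1) ^ card A * ?T A)"
    unfolding inclusion_exclusion_lower_sets[OF P fin U, of "chain_count P k", symmetric]
    by (intro sum.cong refl arg_cong2[where f = "(*)"] sum_chain_count_subset
        lower_set_Diff_maximal_points[OF U]) (use finU in auto)
  also have "\<dots> = ?T {} + (\<Sum>A \<in> Pow ?M - {{}}. (- 1) ^ card A * ?T A)"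
    using M by (simp only: sum_Pow_split_empty) simp
  finally show ?thesis
    by (simp add: sum_negf del: chain_count.simps)
qed

text \<open>Nonempty \<open>A\<close> makes \<open>U - A\<close> small enough for \<open>IH\<close>,
  and summing \<open>s i (U - A)\<close> over \<open>A\<close> gives \<open>s (i + 1) U\<close>. It
  serves both the induction below and the final formula.\<close>

lemma chain_count_Suc_step:
  assumes P: "Partial_order P" and fin: "finite P" and U: "lower_set P U" "card U \<le> Suc m"
    and IH: "\<And>V. lower_set P V \<Longrightarrow> card V \<le> m \<Longrightarrow> chain_count P k V + chain_count P (Suc k) V =
      (\<Sum>i\<le>m. (- 1) ^ (card V + i) * strict_surj_count P i V * int (i choose k))"
  shows "chain_count P (Suc k) U =
    (\<Sum>i\<le>m. (- 1) ^ (card U + Suc i) * strict_surj_count P (Suc i) U * int (i choose k))"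
proof -
  let ?M = "Pow (maximal_points P U) - {{}}"
  have finU: "finite U"
    using U fin finite_Field finite_subset unfolding lower_set_def by blast
  have "chain_count P (Suc k) U = (\<Sum>A \<in> ?M.
      (- 1) ^ Suc (card A) * (chain_count P k (U - A) + chain_count P (Suc k) (U - A)))"
    by (rule chain_count_Suc_alternating[OF P fin U(1)])
  also have "\<dots> = (\<Sum>A \<in> ?M. \<Sum>i\<le>m.
      (- 1) ^ (card U + Suc i) * strict_surj_count P i (U - A) * int (i choose k))"
  proof (rule sum.cong)
    fix A assume A: "A \<in> ?M"
    then have AU: "A \<subseteq> U" "A \<noteq> {}"
      using maximal_points_subset[of P U] by auto
    then have card: "card U = card A + card (U - A)"
      using finU by (metis card_Diff_subset card_mono finite_subset le_add_diff_inverse)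
    have "card A > 0"
      using AU finU by (meson card_gt_0_iff finite_subset)
    then have "card (U - A) \<le> m"
      using card U(2) by linarith
    then have "chain_count P k (U - A) + chain_count P (Suc k) (U - A) =
        (\<Sum>i\<le>m. (- 1) ^ (card (U - A) + i) * strict_surj_count P i (U - A) * int (i choose k))"
      using A U(1) by (intro IH lower_set_Diff_maximal_points) auto
    then show "(- 1) ^ Suc (card A) * (chain_count P k (U - A) + chain_count P (Suc k) (U - A)) =
        (\<Sum>i\<le>m. (- 1) ^ (card U + Suc i) * strict_surj_count P i (U - A) * int (i choose k))"
      \<comment> \<open>The signs combine through
        \<open>card U = card A + card (U - A)\<close>.\<close>
      by (simp only: card sum_distrib_left) (simp add: power_add mult_ac)
  qed simp
  also have "\<dots> = (\<Sum>i\<le>m. \<Sum>A \<in> ?M.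
      (- 1) ^ (card U + Suc i) * strict_surj_count P i (U - A) * int (i choose k))"
    by (rule sum.swap)
  finally show ?thesis
    by (simp only: strict_surj_count.simps sum_distrib_left sum_distrib_right)
qed

text \<open>Induction on a bound \<open>m\<close> for the size, with \<open>k\<close> arbitrary
  since the step for \<open>Suc l\<close> uses the indices \<open>l\<close> and
  \<open>Suc l\<close>.\<close>

lemma chain_count_add_Suc:
  assumes P: "Partial_order P" and fin: "finite P" and U: "lower_set P U" "card U \<le> m"
  shows "chain_count P k U + chain_count P (Suc k) U =
    (\<Sum>i\<le>m. (- 1) ^ (card U + i) * strict_surj_count P i U * int (i choose k))"
  using U
proof (induction m arbitrary: U k)
  case 0
  then have "U = {}"
    using fin finite_Field finite_subset unfolding lower_set_def by fastforce
  then show ?case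
    by (cases k) auto
next
  case (Suc m)
  have step: "chain_count P (Suc k) U =
      (\<Sum>i\<le>m. (- 1) ^ (card U + Suc i) * strict_surj_count P (Suc i) U * int (i choose k))" for k
    by (rule chain_count_Suc_step[OF P fin Suc.prems Suc.IH])
  show ?case
  proof (cases k)
    case 0
    \<comment> \<open>This is exactly the term \<open>i = 0\<close> on the right.\<close>
    have "chain_count P 0 U = (- 1) ^ card U * strict_surj_count P 0 U"
      by auto
    then show ?thesis
      unfolding 0 step by (subst sum.atMost_Suc_shift) simp
  next
    case (Suc l)
    \<comment> \<open>The term \<open>i = 0\<close> vanishes since \<open>0 choose Suc l\<close> is
      0; Pascal's rule merges the two sums given by \<open>step\<close>.\<close>
    show ?thesis
      unfolding Suc step
      by (subst sum.atMost_Suc_shift)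
        (simp del: strict_surj_count.simps add: algebra_simps sum.distrib sum_negf sum_subtractf)
  qed
qed

lemma chain_count_Suc:
  assumes "Partial_order P" "finite P" "lower_set P U" "card U \<le> Suc m"
  shows "chain_count P (Suc k) U =
    (\<Sum>i\<le>m. (- 1) ^ (card U + Suc i) * strict_surj_count P (Suc i) U * int (i choose k))"
  using assms by (intro chain_count_Suc_step chain_count_add_Suc)

section \<open>Shuffles as chains of lower sets\<close>

lemma card_chains:
  assumes "finite U"
  shows "finite {Is. length Is = n \<and> (\<forall>I \<in> set Is. lower_set P I) \<and> sorted_wrt (\<subset>) ({} # Is @ [U])} \<and>
    int (card {Is. length Is = n \<and> (\<forall>I \<in> set Is. lower_set P I) \<and> sorted_wrt (\<subset>) ({} # Is @ [U])}) =
      chain_count P (Suc n) U"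
  using assms
proof (induction n arbitrary: U)
  case 0
  \<comment> \<open>Only \<open>V = {}\<close> contributes to
    \<open>chain_count P (Suc 0) U\<close>.\<close>
  have "{V. lower_set P V \<and> V \<subset> U} \<inter> {{}} = (if U = {} then {} else {{}})"
    by (auto simp: lower_set_def)
  moreover have "finite {V. lower_set P V \<and> V \<subset> U}"
    using 0 by (auto intro: finite_subset[of _ "Pow U"])
  ultimately have "chain_count P (Suc 0) U = of_bool (U \<noteq> {})"
    by simp
  moreover have "{Is. length Is = 0 \<and> (\<forall>I \<in> set Is. lower_set P I) \<and> sorted_wrt (\<subset>) ({} # Is @ [U])} =
      (if U = {} then {} else {[]})"
    by auto
  ultimately show ?case
    by simp
next
  case (Suc n)
  let ?C = "\<lambda>n U. {Is. length Is = n \<and> (\<forall>I \<in> set Is. lower_set P I) \<and> sorted_wrt (\<subset>) ({} # Is @ [U])}"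
  let ?L = "{V. lower_set P V \<and> V \<subset> U}"
  have L: "finite ?L"
    using Suc.prems by (auto intro: finite_subset[of _ "Pow U"])
  have IH: "finite (?C n V)" "int (card (?C n V)) = chain_count P (Suc n) V" if "V \<in> ?L" for V
    using Suc.IH[of V] that Suc.prems by (auto intro: finite_subset)
  \<comment> \<open>Classify chains by their last entry \<open>V\<close>; the earlier entries form a
    chain below \<open>V\<close>. Different \<open>V\<close> give disjoint pieces.\<close>
  have eq: "?C (Suc n) U = (\<Union>V \<in> ?L. (\<lambda>Is. Is @ [V]) ` ?C n V)"
  proof (intro equalityI subsetI)
    fix Js assume Js: "Js \<in> ?C (Suc n) U"
    then obtain Is V where "Js = Is @ [V]"
      by (cases Js rule: rev_cases) auto
    then show "Js \<in> (\<Union>V \<in> ?L. (\<lambda>Is. Is @ [V]) ` ?C n V)"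
      using Js by (auto simp: sorted_wrt_append)
  next
    fix Js assume "Js \<in> (\<Union>V \<in> ?L. (\<lambda>Is. Is @ [V]) ` ?C n V)"
    then obtain Is V where "Js = Is @ [V]" "V \<in> ?L" and Is: "Is \<in> ?C n V"
      by blast
    moreover have "I \<subset> U" if "I \<in> set Is" for I
      using that Is \<open>V \<in> ?L\<close> psubset_trans[of I V U] by (simp add: sorted_wrt_append)
    moreover have "{} \<subset> U"
      using Is \<open>V \<in> ?L\<close> by (auto simp: sorted_wrt_append)
    ultimately show "Js \<in> ?C (Suc n) U"
      by (simp add: sorted_wrt_append)
  qed
  have "card (?C (Suc n) U) = (\<Sum>V \<in> ?L. card ((\<lambda>Is. Is @ [V]) ` ?C n V))"
    unfolding eq using L IH(1) by (intro card_UN_disjoint) auto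
  also have "\<dots> = (\<Sum>V \<in> ?L. card (?C n V))"
    by (intro sum.cong refl card_image) (auto simp: inj_on_def)
  finally have "int (card (?C (Suc n) U)) = chain_count P (Suc (Suc n)) U"
    using IH(2) by (simp only: chain_count.simps(2)[of P "Suc n"] of_nat_sum) (rule sum.cong; simp)
  moreover have "finite (?C (Suc n) U)"
    unfolding eq using L IH(1) by (intro finite_UN_I finite_imageI)
  ultimately show ?case
    by blast
qed

section \<open>Comparison of coefficients\<close>

theorem theorem3p18:
  fixes P :: "'a rel" and n :: nat
  assumes "sp_poset P"
  shows "(- 1) ^ n * coeff (ddSH P) n = int (card (right_deck_divider_shuffles P n))"
proof -
  have P: "Partial_order P" "finite P" "P \<noteq> {}"
    using assms sp_poset_Partial_order sp_poset_finite_nonempty by blast+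
  have F: "finite (Field P)" "Field P \<noteq> {}"
    using P by (simp add: finite_Field, auto simp: Field_def)
  then obtain m where m: "card (Field P) = Suc m"
    by (metis card_eq_0_iff not0_implies_Suc)
  have low: "lower_set P (Field P)"
    by (auto simp: lower_set_def intro: FieldI1)
  have "coeff (ddSH P) n = (\<Sum>i = Suc 0..Suc m.
      (- 1) ^ (Suc m - i) * strict_surj_count P i (Field P) * coeff ([:1, - 1:] ^ (i - 1)) n)"
    by (simp add: ddSH_def m coeff_sum binomial_coeffs_eq_strict_surj_count[OF P(2,3)])
  also have "\<dots> = (\<Sum>i\<le>m.
      (- 1) ^ (m - i) * strict_surj_count P (Suc i) (Field P) * coeff ([:1, - 1:] ^ i) n)"
    unfolding sum.shift_bounds_cl_Suc_ivl atLeast0AtMost by simp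
  also have "\<dots> = (\<Sum>i\<le>m. (- 1) ^ n *
      ((- 1) ^ (card (Field P) + Suc i) * strict_surj_count P (Suc i) (Field P) * int (i choose n)))"
  proof (rule sum.cong)
    fix i assume "i \<in> {..m}"
    \<comment> \<open>The exponents have the same parity because \<open>i \<le> m\<close>.\<close>
    then have "(- 1) ^ (m - i) = ((- 1) ^ (Suc m + Suc i) :: int)"
      by (simp add: uminus_power_if)
    \<comment> \<open>Binomial theorem for \<open>n \<le> i\<close>; for larger \<open>n\<close> the
      degree bound makes both sides 0.\<close>
    moreover have "coeff ([:1, - 1:] ^ i) n = (- 1) ^ n * int (i choose n)"
      using degree_power_le[of "[:1, - 1 :: int:]" i]
      by (cases "n \<le> i") (simp_all add: coeff_linear_poly_power coeff_eq_0)
    ultimately show "(- 1) ^ (m - i) * strict_surj_count P (Suc i) (Field P) * coeff ([:1, - 1:] ^ i) n =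
        (- 1) ^ n * ((- 1) ^ (card (Field P) + Suc i) * strict_surj_count P (Suc i) (Field P) * int (i choose n))"
      by (simp only: m mult_ac)
  qed simp
  also have "\<dots> = (- 1) ^ n * chain_count P (Suc n) (Field P)"
    using m by (subst chain_count_Suc[OF P(1,2) low, of m]) (simp_all only: sum_distrib_left order_refl)
  finally have "(- 1) ^ n * coeff (ddSH P) n = chain_count P (Suc n) (Field P)"
    by (simp add: mult.assoc[symmetric] power_add[symmetric] del: chain_count.simps)
  then show ?thesis
    using card_chains[OF F(1), of n P] by (simp add: right_deck_divider_shuffles_def)
qed

end
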